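(* Let $G=(V,E)$ be a thin LRB graph. Then $(V\cup E\cup\{0\},\cdot)$ is a thin MC left regular band, where the multiplication $\cdot$ on $V\cup E$ is the one defined by rules (1)–(4) in the context and $0$ is an added identity element, i.e. $x\cdot 0=0\cdot x=x$ for all $x\in V\cup E\cup\{0\}$.
   Context: Thin LRB graph (thin left regular band graph): a simple graph $G=(V,E)$ (no loops, at most one edge between any two vertices) with vertex set $V=\{A_i : i\in[n]\}$, whose edges are labeled by pairs $(a,b)\in\mathbb N^2$, written $(A_i,A_j,(a,b))$ for an edge joining $A_i$ and $A_j$, $i\neq j$, with label $(a,b)$, such that no two edges have the same label (so $(a,b)$ also denotes the edge itself), and such that for every simple cycle $\Gamma$ in $G$ and every $a\in\mathbb N$ the number of edges of $\Gamma$ whose label has first component $a$ is even. For vertices $A,B$, take a minimal length path in $G$ from $A$ to $B$, and let $N_a(A,B)$ be the number of edges on it whose label has first component $a$. Multiplication on $V\cup E$: (1) $A_i\cdot x=A_i$ for every vertex $A_i$ and all $x\in V\cup E$. (2) For an edge $(A_i,A_j,(a_1,b_1))$: $(a_1,b_1)\cdot A_i=A_i$ and $(a_1,b_1)\cdot A_j=A_j$. (3) For edges $(a_1,b_1),(a_2,b_2)$ with $a_1=a_2$: $(a_1,b_1)\cdot(a_2,b_2)=(a_1,b_1)$ and $(a_2,b_2)\cdot(a_1,b_1)=(a_2,b_2)$. (4) For two edges $(A_{i_1},A_{j_1},(a_1,b_1))$ and $(A_{i_2},A_{j_2},(a_2,b_2))$: if $a_1\ne a_2$, then $(a_1,b_1)\cdot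 A_{i_2}=(a_1,b_1)\cdot A_{j_2}=(a_1,b_1)\cdot(a_2,b_2)$, and this equals $A_{i_1}$ if $N_{a_1}(A_{j_1},A_{i_2})$ is odd and $A_{j_1}$ otherwise. If $a_1=a_2$, then $(a_1,b_1)\cdot A_{i_2}$ equals $A_{i_1}$ if $N_{a_1}(A_{j_1},A_{i_2})$ is odd and $A_{j_1}$ otherwise, while $(a_1,b_1)\cdot A_{j_2}$ equals $A_{j_1}$ if $N_{a_1}(A_{j_1},A_{i_2})$ is odd and $A_{i_1}$ otherwise. A left regular band is a semigroup $S$ with $x^2=x$ and $xyx=xy$ for all $x,y\in S$. Its face poset is $(S,\le)$ with $y\le x$ iff $yx=x$. Chambers are the maximal elements; a facet is an element covered by a chamber. The adjacency graph has the chambers as vertices and, for each $x\in S$ and each pair of distinct chambers both covering $x$, an edge labeled $x$ between them. $S$ is MC if its face poset is a meet-semilattice and its adjacency graph is connected; an MC left regular band is thin if every facet has exactly two chambers above it.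
   Formalization: The graph G is assumed connected (as needed for the minimal paths defining N_a) and not to consist of a single vertex; for one vertex A the facet 0 has only one chamber above it, so thinness fails. *)

theory Defs
  imports "HOL-Algebra.Lattice"
begin

section \<open>Thin LRB graphs\<close>

text \<open>An edge is the set of its two endpoints, and \<open>lab\<close> assigns to it its label \<open>(a, b)\<close>.\<close>

definition simple_graph :: "'v set \<Rightarrow> 'v set set \<Rightarrow> bool" where
  "simple_graph V E \<longleftrightarrow> finite V \<and> (\<forall>e\<in>E. e \<subseteq> V \<and> card e = 2)"

definition connected_graph :: "'v set \<Rightarrow> 'v set set \<Rightarrow> bool" where
  "connected_graph V E \<longleftrightarrow>
     (\<forall>u\<in>V. \<forall>v\<in>V. (u, v) \<in> {(x, y). x \<in> V \<and> y \<in> V \<and> {x, y} \<in> E}\<^sup>*)"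

fun path_edges :: "'v list \<Rightarrow> 'v set list" where
  "path_edges [] = []"
| "path_edges [x] = []"
| "path_edges (x # y # zs) = {x, y} # path_edges (y # zs)"

definition path_betw :: "'v set \<Rightarrow> 'v set set \<Rightarrow> 'v \<Rightarrow> 'v list \<Rightarrow> 'v \<Rightarrow> bool" where
  "path_betw V E A p B \<longleftrightarrow> p \<noteq> [] \<and> distinct p \<and> hd p = A \<and> last p = B \<and>
     set p \<subseteq> V \<and> set (path_edges p) \<subseteq> E"

definition minimal_path :: "'v set \<Rightarrow> 'v set set \<Rightarrow> 'v \<Rightarrow> 'v list \<Rightarrow> 'v \<Rightarrow> bool" where
  "minimal_path V E A p B \<longleftrightarrow> path_betw V E A p B \<and>
     (\<forall>q. path_betw V E A q B \<longrightarrow> length p \<le> length q)"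

text \<open>A simple cycle is given by its list of pairwise distinct vertices; the closing edge
  from the last vertex back to the first is not repeated in the list.\<close>

definition cycle_edges :: "'v list \<Rightarrow> 'v set list" where
  "cycle_edges c = path_edges (c @ [hd c])"

definition simple_cycle :: "'v set \<Rightarrow> 'v set set \<Rightarrow> 'v list \<Rightarrow> bool" where
  "simple_cycle V E c \<longleftrightarrow> 3 \<le> length c \<and> distinct c \<and> set c \<subseteq> V \<and> set (cycle_edges c) \<subseteq> E"

definition count_label1 :: "('v set \<Rightarrow> nat \<times> nat) \<Rightarrow> nat \<Rightarrow> 'v set list \<Rightarrow> nat" where
  "count_label1 lab a es = length (filter (\<lambda>e. fst (lab e) = a) es)"

definition thin_LRB_graph :: "'v set \<Rightarrow> 'v set set \<Rightarrow> ('v set \<Rightarrow> nat \<times> nat) \<Rightarrow> bool" where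
  "thin_LRB_graph V E lab \<longleftrightarrow> simple_graph V E \<and> inj_on lab E \<and>
     (\<forall>c a. simple_cycle V E c \<longrightarrow> even (count_label1 lab a (cycle_edges c)))"


section \<open>The multiplication\<close>

text \<open>\<open>sp A B\<close> is the chosen minimal length path from \<open>A\<close> to \<open>B\<close>; the choice is arbitrary.\<close>

definition minimal_path_choice :: "'v set \<Rightarrow> 'v set set \<Rightarrow> ('v \<Rightarrow> 'v \<Rightarrow> 'v list) \<Rightarrow> bool" where
  "minimal_path_choice V E sp \<longleftrightarrow> (\<forall>A\<in>V. \<forall>B\<in>V. minimal_path V E A (sp A B) B)"

definition N :: "('v set \<Rightarrow> nat \<times> nat) \<Rightarrow> ('v \<Rightarrow> 'v \<Rightarrow> 'v list) \<Rightarrow> nat \<Rightarrow> 'v \<Rightarrow> 'v \<Rightarrow> nat" where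
  "N lab sp a A B = count_label1 lab a (path_edges (sp A B))"

datatype 'v elt = Vertex 'v | Edge "'v set" | Zero

definition elts :: "'v set \<Rightarrow> 'v set set \<Rightarrow> 'v elt set" where
  "elts V E = Vertex ` V \<union> Edge ` E \<union> {Zero}"

text \<open>The clauses quantify over all ways of writing an unordered edge with its endpoints in
  some order, so the existence of such an \<open>m\<close> includes independence of that order.\<close>

definition graph_mult ::
  "'v set \<Rightarrow> 'v set set \<Rightarrow> ('v set \<Rightarrow> nat \<times> nat) \<Rightarrow> ('v \<Rightarrow> 'v \<Rightarrow> 'v list)
    \<Rightarrow> ('v elt \<Rightarrow> 'v elt \<Rightarrow> 'v elt) \<Rightarrow> bool" where
  "graph_mult V E lab sp m \<longleftrightarrow>
     (\<forall>A\<in>V. \<forall>x \<in> Vertex ` V \<union> Edge ` E. m (Vertex A) x = Vertex A) \<and>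
     (\<forall>A B. {A, B} \<in> E \<longrightarrow>
        m (Edge {A, B}) (Vertex A) = Vertex A \<and> m (Edge {A, B}) (Vertex B) = Vertex B) \<and>
     (\<forall>e\<in>E. \<forall>f\<in>E. fst (lab e) = fst (lab f) \<longrightarrow>
        m (Edge e) (Edge f) = Edge e \<and> m (Edge f) (Edge e) = Edge f) \<and>
     (\<forall>A1 B1 A2 B2 a1 b1 a2 b2.
        {A1, B1} \<in> E \<and> lab {A1, B1} = (a1, b1) \<and> {A2, B2} \<in> E \<and> lab {A2, B2} = (a2, b2) \<longrightarrow>
        (a1 \<noteq> a2 \<longrightarrow>
           (let P = (if odd (N lab sp a1 B1 A2) then A1 else B1) in
              m (Edge {A1, B1}) (Vertex A2) = Vertex P \<and>
              m (Edge {A1, B1}) (Vertex B2) = Vertex P \<and>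
              m (Edge {A1, B1}) (Edge {A2, B2}) = Vertex P)) \<and>
        (a1 = a2 \<longrightarrow>
           m (Edge {A1, B1}) (Vertex A2) = Vertex (if odd (N lab sp a1 B1 A2) then A1 else B1) \<and>
           m (Edge {A1, B1}) (Vertex B2) = Vertex (if odd (N lab sp a1 B1 A2) then B1 else A1))) \<and>
     (\<forall>x \<in> elts V E. m x Zero = x \<and> m Zero x = x)"


section \<open>Thin MC left regular bands\<close>

definition left_regular_band :: "'a set \<Rightarrow> ('a \<Rightarrow> 'a \<Rightarrow> 'a) \<Rightarrow> bool" where
  "left_regular_band S m \<longleftrightarrow>
     (\<forall>x\<in>S. \<forall>y\<in>S. m x y \<in> S) \<and>
     (\<forall>x\<in>S. \<forall>y\<in>S. \<forall>z\<in>S. m (m x y) z = m x (m y z)) \<and>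
     (\<forall>x\<in>S. m x x = x) \<and>
     (\<forall>x\<in>S. \<forall>y\<in>S. m (m x y) x = m x y)"

definition face_le :: "('a \<Rightarrow> 'a \<Rightarrow> 'a) \<Rightarrow> 'a \<Rightarrow> 'a \<Rightarrow> bool" where
  "face_le m y x \<longleftrightarrow> m y x = x"

definition face_poset :: "'a set \<Rightarrow> ('a \<Rightarrow> 'a \<Rightarrow> 'a) \<Rightarrow> 'a gorder" where
  "face_poset S m = \<lparr>carrier = S, eq = (=), le = face_le m\<rparr>"

definition covers :: "'a set \<Rightarrow> ('a \<Rightarrow> 'a \<Rightarrow> 'a) \<Rightarrow> 'a \<Rightarrow> 'a \<Rightarrow> bool" where
  "covers S m x y \<longleftrightarrow> face_le m y x \<and> y \<noteq> x \<and>
     \<not> (\<exists>z\<in>S. face_le m y z \<and> face_le m z x \<and> z \<noteq> y \<and> z \<noteq> x)"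

definition chambers :: "'a set \<Rightarrow> ('a \<Rightarrow> 'a \<Rightarrow> 'a) \<Rightarrow> 'a set" where
  "chambers S m = {C \<in> S. \<forall>x\<in>S. face_le m C x \<longrightarrow> x = C}"

definition facets :: "'a set \<Rightarrow> ('a \<Rightarrow> 'a \<Rightarrow> 'a) \<Rightarrow> 'a set" where
  "facets S m = {x \<in> S. \<exists>C \<in> chambers S m. covers S m C x}"

text \<open>The adjacency graph may have parallel edges; each edge carries its label \<open>x\<close> in the
  first component.\<close>

definition adjacency_edges :: "'a set \<Rightarrow> ('a \<Rightarrow> 'a \<Rightarrow> 'a) \<Rightarrow> ('a \<times> 'a set) set" where
  "adjacency_edges S m = {(x, {C, D}) | x C D. x \<in> S \<and> C \<in> chambers S m \<and> D \<in> chambers S m \<and>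
     C \<noteq> D \<and> covers S m C x \<and> covers S m D x}"

definition MC_LRB :: "'a set \<Rightarrow> ('a \<Rightarrow> 'a \<Rightarrow> 'a) \<Rightarrow> bool" where
  "MC_LRB S m \<longleftrightarrow> left_regular_band S m \<and>
     lower_semilattice (face_poset S m) \<and>
     connected_graph (chambers S m) (snd ` adjacency_edges S m)"

definition thin_MC_LRB :: "'a set \<Rightarrow> ('a \<Rightarrow> 'a \<Rightarrow> 'a) \<Rightarrow> bool" where
  "thin_MC_LRB S m \<longleftrightarrow> MC_LRB S m \<and>
     (\<forall>x \<in> facets S m. card {C \<in> chambers S m. face_le m x C} = 2)"

end

theory Submission
  imports Defs
begin

text \<open>Splitting a closed walk at a repeated vertex shows that every closed walk, not only
  every simple cycle, contains an even number of edges with a given first label \<open>a\<close>. Hence the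
  vertices fall into two sides with respect to \<open>a\<close>, and an edge joins different sides exactly if
  its first label is \<open>a\<close>. Multiplying a vertex from the left by an edge \<open>e\<close> with first label \<open>a\<close>
  yields the endpoint of \<open>e\<close> on the same \<open>a\<close>-side, from which all the axioms follow. In the face
  poset, \<open>0\<close> lies below the edges and each edge lies below its two endpoints.\<close>

section \<open>Parity of label counts along walks\<close>

lemma path_edges_append: "path_edges (xs @ y # zs) = path_edges (xs @ [y]) @ path_edges (y # zs)"
proof (induction xs)
  case (Cons x xs)
  then show ?case by (cases xs) auto
qed simp

lemma path_edges_rev: "path_edges (rev p) = rev (path_edges p)"
proof (induction p rule: path_edges.induct)
  case (3 x y zs)
  then show ?case
    using path_edges_append[of "rev zs" y "[x]"] by (simp add: insert_commute)
qed auto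

lemma count_label1_append:
  "count_label1 lab a (xs @ ys) = count_label1 lab a xs + count_label1 lab a ys"
  by (simp add: count_label1_def)

lemma count_label1_rev: "count_label1 lab a (rev xs) = count_label1 lab a xs"
  by (simp add: count_label1_def rev_filter[symmetric])

text \<open>Recovers the vertices of a walk from its edges: once all edges lie in \<open>E\<close>,
  all vertices lie in \<open>V\<close>. A one-vertex list has no edges, hence the bound on the
  length.\<close>

lemma set_subset_path_edges: "2 \<le> length p \<Longrightarrow> set p \<subseteq> \<Union> (set (path_edges p))"
proof (induction p rule: path_edges.induct)
  case (3 x y zs)
  then show ?case by (cases zs) auto
qed auto

locale thin_graph =
  fixes V :: "'v set" and E :: "'v set set" and lab :: "'v set \<Rightarrow> nat \<times> nat"
    and sp :: "'v \<Rightarrow> 'v \<Rightarrow> 'v list"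
  assumes thin: "thin_LRB_graph V E lab"
    and sp: "minimal_path_choice V E sp"
begin

lemma edge_in_V: "{A, B} \<in> E \<Longrightarrow> A \<in> V \<and> B \<in> V \<and> A \<noteq> B"
  using thin unfolding thin_LRB_graph_def simple_graph_def by fastforce

lemma edgeE:
  assumes "e \<in> E"
  obtains A B where "e = {A, B}" "A \<noteq> B" "A \<in> V" "B \<in> V"
proof -
  have "card e = 2" using assms thin unfolding thin_LRB_graph_def simple_graph_def by auto
  then obtain A B where "e = {A, B}" by (auto simp: card_2_iff)
  then show thesis using assms edge_in_V that by blast
qed

text \<open>Strong induction on the length. A repeated vertex cuts the closed walk into two shorter
  ones that share out its edges, so their even counts add up; without a repetition the walk is a
  simple cycle or has at most two vertices.\<close>

lemma even_cycle_edges: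
  assumes "c \<noteq> []" "set (cycle_edges c) \<subseteq> E"
  shows "even (count_label1 lab a (cycle_edges c))"
  using assms
proof (induction "length c" arbitrary: c rule: less_induct)
  case less
  show ?case
  proof (cases "distinct c")
    case True
    \<comment> \<open>A simple cycle has at least three vertices, so shorter distinct lists are
      treated separately: one vertex would need a loop, and two vertices traverse the same edge
      twice, which counts 0 or 2.\<close>
    consider x where "c = [x]" | x y where "c = [x, y]" | "3 \<le> length c"
    proof (cases c rule: path_edges.cases)
      case (3 x y zs)
      then show thesis using that by (cases zs) simp_all
    qed (use less.prems(1) that in auto)
    then show ?thesis
    proof cases
      case 1
      then show ?thesis using less.prems(2) edge_in_V[of x x] by (simp add: cycle_edges_def)
    next
      case 2
      then show ?thesis by (simp add: cycle_edges_def count_label1_def insert_commute)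
    next
      case 3
      have "set c \<subseteq> \<Union> (set (cycle_edges c))"
        using set_subset_path_edges[of "c @ [hd c]"] 3 by (auto simp: cycle_edges_def)
      also have "\<dots> \<subseteq> V"
        using less.prems thin unfolding thin_LRB_graph_def simple_graph_def by blast
      finally show ?thesis
        using thin True 3 less.prems unfolding thin_LRB_graph_def simple_cycle_def by blast
    qed
  next
    case False
    then obtain xs y ys zs where c: "c = xs @ y # ys @ y # zs"
      using not_distinct_decomp[OF False] by auto
    \<comment> \<open>\<open>?c1\<close> is the detour from \<open>y\<close> back to
      \<open>y\<close>, and \<open>?c2\<close> is the walk \<open>c\<close> with this detour left
      out.\<close>
    let ?c1 = "y # ys" and ?c2 = "xs @ y # zs"
    \<comment> \<open>The closing edge returns to the same vertex in both walks; if
      \<open>xs\<close> is empty, that vertex is \<open>y\<close>.\<close>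
    have hd: "hd c = hd ?c2" using c by (cases xs) auto
    have c0: "cycle_edges c = path_edges (xs @ [y]) @ path_edges (y # ys @ [y]) @
        path_edges (y # zs @ [hd c])"
      using path_edges_append[of xs y "ys @ y # zs @ [hd c]"]
        path_edges_append[of "y # ys" y "zs @ [hd c]"] unfolding cycle_edges_def
      by (subst (1) c) simp
    have c1: "cycle_edges ?c1 = path_edges (y # ys @ [y])"
      by (simp add: cycle_edges_def)
    have c2: "cycle_edges ?c2 = path_edges (xs @ [y]) @ path_edges (y # zs @ [hd c])"
      using path_edges_append[of xs y "zs @ [hd c]"] unfolding cycle_edges_def hd by simp
    have len: "length ?c1 < length c" "length ?c2 < length c"
      by (simp_all add: c)
    have sub: "set (cycle_edges ?c1) \<subseteq> E" "set (cycle_edges ?c2) \<subseteq> E"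
      using less.prems(2) unfolding c0 c1 c2 by auto
    have "even (count_label1 lab a (cycle_edges ?c1))" "even (count_label1 lab a (cycle_edges ?c2))"
      by (rule less.hyps[OF len(1) _ sub(1)], simp) (rule less.hyps[OF len(2) _ sub(2)], simp)
    then show ?thesis unfolding c0 c1 c2 by (auto simp: count_label1_append)
  qed
qed

text \<open>Transfers the parity to lists that repeat the start vertex at the end; dropping the last
  entry gives the form used by \<open>cycle_edges\<close>.\<close>

lemma even_closed_walk:
  assumes "p \<noteq> []" "hd p = last p" "set (path_edges p) \<subseteq> E"
  shows "even (count_label1 lab a (path_edges p))"
proof (cases "butlast p = []")
  case True
  then obtain x where "p = [x]" using assms(1) by (metis append_butlast_last_id append_Nil)
  then show ?thesis by (simp add: count_label1_def)
next
  case False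
  have "p = butlast p @ [hd (butlast p)]"
    using assms False by (metis append_butlast_last_id hd_append2)
  then have "path_edges p = cycle_edges (butlast p)" by (simp add: cycle_edges_def)
  then show ?thesis using even_cycle_edges[OF False] assms(3) by simp
qed

section \<open>The two sides of the vertex set with respect to a first label\<close>

lemma sp_path: "A \<in> V \<Longrightarrow> B \<in> V \<Longrightarrow> path_betw V E A (sp A B) B"
  using sp unfolding minimal_path_choice_def minimal_path_def by blast

definition same_side :: "nat \<Rightarrow> 'v \<Rightarrow> 'v \<Rightarrow> bool" where
  "same_side a A B \<longleftrightarrow> even (N lab sp a A B)"

text \<open>Going along \<open>p\<close> and back along the chosen path is a closed walk, so both
  have the same parity. Hence sides do not depend on the choice of minimal paths.\<close>

lemma even_walk:
  assumes "p \<noteq> []" "hd p \<in> V" "last p \<in> V" "set (path_edges p) \<subseteq> E"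
  shows "even (count_label1 lab a (path_edges p)) \<longleftrightarrow> same_side a (hd p) (last p)"
proof -
  let ?s = "rev (sp (hd p) (last p))"
  have s: "?s \<noteq> []" "hd ?s = last p" "last ?s = hd p" "set (path_edges ?s) \<subseteq> E"
    using sp_path[OF assms(2,3)] by (auto simp: path_betw_def hd_rev last_rev path_edges_rev)
  \<comment> \<open>The last vertex of \<open>p\<close> is the first of \<open>?s\<close>;
    \<open>butlast\<close> keeps it from appearing twice.\<close>
  have e: "path_edges (butlast p @ ?s) = path_edges p @ path_edges ?s"
    using path_edges_append[of "butlast p" "last p" "tl ?s"] s assms(1)
    by (metis append_butlast_last_id hd_Cons_tl)
  have "hd (butlast p @ ?s) = hd p"
    using s(2) assms(1) by (cases p) auto
  then have "even (count_label1 lab a (path_edges (butlast p @ ?s)))"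
    using s assms(4) e by (intro even_closed_walk) auto
  then show ?thesis
    by (simp add: e count_label1_append same_side_def N_def path_edges_rev count_label1_rev)
qed

lemma same_side_refl: "A \<in> V \<Longrightarrow> same_side a A A"
  using even_walk[of "[A]" a] by (simp add: count_label1_def)

lemma same_side_edge:
  assumes "{A, B} \<in> E"
  shows "same_side a A B \<longleftrightarrow> fst (lab {A, B}) \<noteq> a"
proof -
  have "same_side a A B \<longleftrightarrow> even (count_label1 lab a (path_edges [A, B]))"
    using even_walk[of "[A, B]" a] edge_in_V[OF assms] assms by simp
  then show ?thesis by (simp add: count_label1_def)
qed

text \<open>Parities add when the chosen paths are concatenated. Together with reflexivity this
  makes \<open>same_side a\<close> an equivalence relation with at most two classes.\<close>

lemma same_side_compose:
  assumes "A \<in> V" "B \<in> V" "C \<in> V"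
  shows "same_side a A C \<longleftrightarrow> (same_side a A B \<longleftrightarrow> same_side a B C)"
proof -
  let ?p = "sp A B" and ?q = "sp B C"
  have p: "?p \<noteq> []" "hd ?p = A" "last ?p = B" "set (path_edges ?p) \<subseteq> E"
    and q: "?q \<noteq> []" "hd ?q = B" "last ?q = C" "set (path_edges ?q) \<subseteq> E"
    using sp_path assms by (auto simp: path_betw_def)
  have e: "path_edges (butlast ?p @ ?q) = path_edges ?p @ path_edges ?q"
    using path_edges_append[of "butlast ?p" B "tl ?q"] p q
    by (metis append_butlast_last_id hd_Cons_tl)
  have "hd (butlast ?p @ ?q) = A"
    using p q by (cases ?p) auto
  then show ?thesis
    using even_walk[of "butlast ?p @ ?q" a] p q e assms
    by (simp add: count_label1_append same_side_def N_def)
qed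


section \<open>The multiplication in terms of sides\<close>

definition proj :: "'v set \<Rightarrow> 'v \<Rightarrow> 'v" where
  "proj e X = (THE P. P \<in> e \<and> same_side (fst (lab e)) P X)"

text \<open>The endpoints of \<open>e\<close> lie on opposite sides for the first label of
  \<open>e\<close>, and there are only two sides; this justifies the definite description in
  \<open>proj\<close>.\<close>

lemma proj_ex1:
  assumes "e \<in> E" "X \<in> V"
  shows "\<exists>!P. P \<in> e \<and> same_side (fst (lab e)) P X"
proof -
  obtain A B where e: "e = {A, B}" "A \<noteq> B" "A \<in> V" "B \<in> V"
    using edgeE[OF assms(1)] by blast
  have "\<not> same_side (fst (lab e)) A B" using same_side_edge e assms by auto
  then have "same_side (fst (lab e)) A X \<longleftrightarrow> \<not> same_side (fst (lab e)) B X"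
    using same_side_compose e assms by blast
  then show ?thesis using e by blast
qed

lemma proj_in: "e \<in> E \<Longrightarrow> X \<in> V \<Longrightarrow> proj e X \<in> e"
  and proj_same_side: "e \<in> E \<Longrightarrow> X \<in> V \<Longrightarrow> same_side (fst (lab e)) (proj e X) X"
  using theI'[OF proj_ex1] unfolding proj_def by blast+

lemma proj_eqI:
  "e \<in> E \<Longrightarrow> X \<in> V \<Longrightarrow> P \<in> e \<Longrightarrow> same_side (fst (lab e)) P X \<Longrightarrow> proj e X = P"
  using proj_ex1 proj_in proj_same_side by blast

lemma in_V: "e \<in> E \<Longrightarrow> X \<in> e \<Longrightarrow> X \<in> V"
  using edgeE by blast

lemma proj_in_V: "e \<in> E \<Longrightarrow> X \<in> V \<Longrightarrow> proj e X \<in> V"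
  using proj_in in_V by blast

lemma proj_fixes_iff: "e \<in> E \<Longrightarrow> X \<in> V \<Longrightarrow> proj e X = X \<longleftrightarrow> X \<in> e"
  using proj_in proj_eqI same_side_refl by metis

lemma proj_cong:
  assumes "e \<in> E" "X \<in> V" "Y \<in> V" "same_side (fst (lab e)) X Y"
  shows "proj e X = proj e Y"
  using assms proj_eqI proj_in proj_same_side proj_in_V same_side_compose by metis

text \<open>Links sides to the formula of rule (4): an odd count from \<open>B\<close> to
  \<open>X\<close> puts \<open>X\<close> on the side of \<open>A\<close>.\<close>

lemma proj_pair:
  assumes "{A, B} \<in> E" "X \<in> V"
  shows "proj {A, B} X = (if odd (N lab sp (fst (lab {A, B})) B X) then A else B)"
proof -
  have "proj {A, B} X = B \<longleftrightarrow> same_side (fst (lab {A, B})) B X"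
    using proj_eqI proj_same_side assms by (metis insertCI)
  moreover have "proj {A, B} X \<in> {A, B}" using proj_in assms by blast
  ultimately show ?thesis by (auto simp: same_side_def)
qed

text \<open>Serves the case of equal first labels in rule (4), where the endpoints \<open>X\<close>
  and \<open>Y\<close> of the second edge lie on opposite sides and so have opposite
  projections.\<close>

lemma proj_pair_swap:
  assumes "{A, B} \<in> E" "X \<in> V" "Y \<in> V" "\<not> same_side (fst (lab {A, B})) X Y"
  shows "proj {A, B} Y = (if odd (N lab sp (fst (lab {A, B})) B X) then B else A)"
proof -
  have "odd (N lab sp (fst (lab {A, B})) B X) \<longleftrightarrow> even (N lab sp (fst (lab {A, B})) B Y)"
    using same_side_compose[of B X Y] assms edge_in_V by (simp add: same_side_def)
  then show ?thesis using proj_pair assms by simp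
qed

text \<open>Makes the product of two edges with different first labels independent of the endpoint
  used to compute it.\<close>

lemma same_side_endpoints:
  assumes "f \<in> E" "X \<in> f" "Y \<in> f" "fst (lab f) \<noteq> a"
  shows "same_side a X Y"
proof (cases "X = Y")
  case True
  then show ?thesis using assms in_V same_side_refl by blast
next
  case False
  moreover obtain A B where "f = {A, B}" using edgeE[OF assms(1)] by blast
  ultimately have "f = {X, Y}" using assms(2,3) by auto
  then show ?thesis using same_side_edge assms by blast
qed

definition side_mult :: "('v elt \<Rightarrow> 'v elt \<Rightarrow> 'v elt) \<Rightarrow> bool" where
  "side_mult m \<longleftrightarrow>
     (\<forall>A\<in>V. \<forall>x \<in> elts V E. m (Vertex A) x = Vertex A) \<and>
     (\<forall>e\<in>E. \<forall>X\<in>V. m (Edge e) (Vertex X) = Vertex (proj e X)) \<and>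
     (\<forall>e\<in>E. \<forall>f\<in>E. fst (lab e) = fst (lab f) \<longrightarrow> m (Edge e) (Edge f) = Edge e) \<and>
     (\<forall>e\<in>E. \<forall>f\<in>E. \<forall>X\<in>f. fst (lab e) \<noteq> fst (lab f) \<longrightarrow>
        m (Edge e) (Edge f) = Vertex (proj e X)) \<and>
     (\<forall>x \<in> elts V E. m x Zero = x \<and> m Zero x = x)"

section \<open>Existence of the multiplication\<close>

lemma side_mult_ex: "\<exists>m. side_mult m"
proof
  \<comment> \<open>The witness picks an arbitrary endpoint of \<open>f\<close>; all endpoints of
    \<open>f\<close> lie on one side for the first label of \<open>e\<close>, so the projection is
    the same for each.\<close>
  let ?m = "\<lambda>x y. case x of Zero \<Rightarrow> y | Vertex A \<Rightarrow> x | Edge e \<Rightarrow>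
    (case y of Zero \<Rightarrow> x | Vertex X \<Rightarrow> Vertex (proj e X) | Edge f \<Rightarrow>
      if fst (lab e) = fst (lab f) then x else Vertex (proj e (SOME X. X \<in> f)))"
  have "proj e (SOME X. X \<in> f) = proj e X"
    if "e \<in> E" "f \<in> E" "X \<in> f" "fst (lab e) \<noteq> fst (lab f)" for e f X
  proof -
    have s: "(SOME X. X \<in> f) \<in> f" using that(3) by (rule someI)
    show ?thesis
      by (rule proj_cong[OF that(1) in_V[OF that(2) s] in_V[OF that(2,3)]
            same_side_endpoints[OF that(2) s that(3) that(4)[symmetric]]])
  qed
  then show "side_mult ?m" unfolding side_mult_def by (auto split: elt.split)
qed

lemma
  assumes "side_mult m"
  shows side_mult_vertex: "A \<in> V \<Longrightarrow> x \<in> elts V E \<Longrightarrow> m (Vertex A) x = Vertex A"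
    and side_mult_edge_vertex: "e \<in> E \<Longrightarrow> X \<in> V \<Longrightarrow> m (Edge e) (Vertex X) = Vertex (proj e X)"
    and side_mult_edge_edge_eq:
      "e \<in> E \<Longrightarrow> f \<in> E \<Longrightarrow> fst (lab e) = fst (lab f) \<Longrightarrow> m (Edge e) (Edge f) = Edge e"
    and side_mult_edge_edge_neq:
      "e \<in> E \<Longrightarrow> f \<in> E \<Longrightarrow> fst (lab e) \<noteq> fst (lab f) \<Longrightarrow> X \<in> f \<Longrightarrow>
        m (Edge e) (Edge f) = Vertex (proj e X)"
    and side_mult_Zero: "x \<in> elts V E \<Longrightarrow> m x Zero = x \<and> m Zero x = x"
proof -
  note c = assms[unfolded side_mult_def]
  note c1 = conjunct1[OF c] conjunct2[OF c]
  note c2 = conjunct1[OF c1(2)] conjunct2[OF c1(2)]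
  note c3 = conjunct1[OF c2(2)] conjunct2[OF c2(2)]
  note c4 = conjunct1[OF c3(2)] conjunct2[OF c3(2)]
  show "A \<in> V \<Longrightarrow> x \<in> elts V E \<Longrightarrow> m (Vertex A) x = Vertex A"
    by (rule c1(1)[rule_format])
  show "e \<in> E \<Longrightarrow> X \<in> V \<Longrightarrow> m (Edge e) (Vertex X) = Vertex (proj e X)"
    by (rule c2(1)[rule_format])
  show "e \<in> E \<Longrightarrow> f \<in> E \<Longrightarrow> fst (lab e) = fst (lab f) \<Longrightarrow> m (Edge e) (Edge f) = Edge e"
    by (rule c3(1)[rule_format])
  show "e \<in> E \<Longrightarrow> f \<in> E \<Longrightarrow> fst (lab e) \<noteq> fst (lab f) \<Longrightarrow> X \<in> f \<Longrightarrow>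
        m (Edge e) (Edge f) = Vertex (proj e X)"
    by (rule c4(1)[rule_format])
  show "x \<in> elts V E \<Longrightarrow> m x Zero = x \<and> m Zero x = x"
    by (rule c4(2)[THEN bspec])
qed

lemma side_mult_graph_mult:
  assumes "side_mult m"
  shows "graph_mult V E lab sp m"
proof -
  note v = side_mult_vertex[OF assms] and ev = side_mult_edge_vertex[OF assms]
    and ee = side_mult_edge_edge_eq[OF assms] and ef = side_mult_edge_edge_neq[OF assms]
    and z = side_mult_Zero[OF assms]
  have fix_: "m (Edge {A, B}) (Vertex A) = Vertex A \<and> m (Edge {A, B}) (Vertex B) = Vertex B"
    if "{A, B} \<in> E" for A B
    using ev[OF that] proj_fixes_iff[OF that] edge_in_V[OF that] by simp
  have neq: "m (Edge {A1, B1}) (Vertex A2) = Vertex P \<and> m (Edge {A1, B1}) (Vertex B2) = Vertex P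
      \<and> m (Edge {A1, B1}) (Edge {A2, B2}) = Vertex P"
    if "{A1, B1} \<in> E" "{A2, B2} \<in> E" "lab {A1, B1} = (a1, b1)" "lab {A2, B2} = (a2, b2)" "a1 \<noteq> a2"
      "P = (if odd (N lab sp a1 B1 A2) then A1 else B1)" for A1 B1 A2 B2 a1 b1 a2 b2 P
  proof -
    have P: "P = proj {A1, B1} A2"
      using proj_pair[OF that(1), of A2] that(3,6) edge_in_V[OF that(2)] by simp
    \<comment> \<open>An edge whose first label is not \<open>a1\<close> stays within one side for
      \<open>a1\<close>.\<close>
    have "proj {A1, B1} A2 = proj {A1, B1} B2"
      using that edge_in_V[OF that(2)] by (intro proj_cong) (simp_all add: same_side_edge)
    then show ?thesis
      using P ev[OF that(1)] ef[OF that(1,2), of A2] that(3-5) edge_in_V[OF that(2)] by simp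
  qed
  \<comment> \<open>Here the second edge crosses sides, so its endpoints are sent to different
    endpoints of the first edge.\<close>
  have eq: "m (Edge {A1, B1}) (Vertex A2) = Vertex (if odd (N lab sp a B1 A2) then A1 else B1) \<and>
      m (Edge {A1, B1}) (Vertex B2) = Vertex (if odd (N lab sp a B1 A2) then B1 else A1)"
    if "{A1, B1} \<in> E" "{A2, B2} \<in> E" "lab {A1, B1} = (a, b1)" "lab {A2, B2} = (a, b2)"
    for A1 B1 A2 B2 a b1 b2
    using ev[OF that(1)] edge_in_V[OF that(2)] proj_pair[OF that(1), of A2]
      proj_pair_swap[OF that(1), of A2 B2] same_side_edge[OF that(2)] that(3,4) by simp
  show ?thesis
    unfolding graph_mult_def Let_def
  proof (intro conjI)
    show "\<forall>A\<in>V. \<forall>x\<in>Vertex ` V \<union> Edge ` E. m (Vertex A) x = Vertex A"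
      using v unfolding elts_def by blast
  next
    show "\<forall>e\<in>E. \<forall>f\<in>E. fst (lab e) = fst (lab f) \<longrightarrow>
        m (Edge e) (Edge f) = Edge e \<and> m (Edge f) (Edge e) = Edge f"
      using ee by simp
  next
    show "\<forall>A1 B1 A2 B2 a1 b1 a2 b2.
        {A1, B1} \<in> E \<and> lab {A1, B1} = (a1, b1) \<and> {A2, B2} \<in> E \<and> lab {A2, B2} = (a2, b2) \<longrightarrow>
        (a1 \<noteq> a2 \<longrightarrow>
          m (Edge {A1, B1}) (Vertex A2) = Vertex (if odd (N lab sp a1 B1 A2) then A1 else B1) \<and>
          m (Edge {A1, B1}) (Vertex B2) = Vertex (if odd (N lab sp a1 B1 A2) then A1 else B1) \<and>
          m (Edge {A1, B1}) (Edge {A2, B2}) = Vertex (if odd (N lab sp a1 B1 A2) then A1 else B1)) \<and>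
        (a1 = a2 \<longrightarrow>
          m (Edge {A1, B1}) (Vertex A2) = Vertex (if odd (N lab sp a1 B1 A2) then A1 else B1) \<and>
          m (Edge {A1, B1}) (Vertex B2) = Vertex (if odd (N lab sp a1 B1 A2) then B1 else A1))"
      by (intro allI impI conjI[OF impI impI]; elim conjE) (rule neq eq; (assumption | simp))+
  qed (use fix_ z in simp_all)
qed

end

text \<open>The paths \<open>sp A B\<close> link all vertices, so excluding a single vertex leaves
  every vertex on some edge. With one vertex, \<open>Zero\<close> would be a facet with only one
  chamber above it.\<close>

locale thin_connected_graph = thin_graph +
  assumes card_V: "card V \<noteq> 1"
begin

text \<open>The first step of the chosen path to any other vertex is such an edge.\<close>

lemma edge_at:
  assumes "A \<in> V"
  obtains B where "{A, B} \<in> E"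
proof -
  obtain B where B: "B \<in> V" "B \<noteq> A"
    using assms card_V is_singletonI' is_singleton_altdef by (metis empty_iff)
  have p: "path_betw V E A (sp A B) B" using sp_path assms B by blast
  then obtain y zs where "sp A B = A # y # zs"
    using B by (cases "sp A B" rule: path_edges.cases) (auto simp: path_betw_def)
  then show thesis using p that by (auto simp: path_betw_def)
qed

lemma graph_mult_side_mult:
  assumes "graph_mult V E lab sp m"
  shows "side_mult m"
proof -
  note c = assms[unfolded graph_mult_def Let_def]
  note c1 = conjunct1[OF c] conjunct2[OF c]
  note c2 = conjunct2[OF c1(2)]
  note c3 = conjunct1[OF c2] conjunct2[OF c2]
  note c4 = conjunct1[OF c3(2)] conjunct2[OF c3(2)]
  have v: "m (Vertex A) x = Vertex A" if "A \<in> V" "x \<in> elts V E" for A x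
    using c1(1) c4(2) that unfolding elts_def by blast
  have ee: "m (Edge e) (Edge f) = Edge e" if "e \<in> E" "f \<in> E" "fst (lab e) = fst (lab f)" for e f
    using c3(1) that by blast
  \<comment> \<open>Only values at the first endpoint \<open>A2\<close> are extracted; reordering
    the second edge brings either endpoint to that position.\<close>
  have rule4: "m (Edge {A1, B1}) (Vertex A2) = Vertex (proj {A1, B1} A2) \<and>
      (fst (lab {A1, B1}) \<noteq> fst (lab {A2, B2}) \<longrightarrow>
        m (Edge {A1, B1}) (Edge {A2, B2}) = Vertex (proj {A1, B1} A2))"
    if "{A1, B1} \<in> E" "{A2, B2} \<in> E" for A1 B1 A2 B2
  proof -
    obtain a1 b1 a2 b2 where l: "lab {A1, B1} = (a1, b1)" "lab {A2, B2} = (a2, b2)"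
      by fastforce
    have "{A1, B1} \<in> E \<and> lab {A1, B1} = (a1, b1) \<and> {A2, B2} \<in> E \<and> lab {A2, B2} = (a2, b2)"
      using that l by simp
    from c4(1)[THEN spec, THEN spec, THEN spec, THEN spec, THEN spec, THEN spec, THEN spec,
        THEN spec, THEN mp, OF this]
    show ?thesis
      using l proj_pair[OF that(1)] edge_in_V[OF that(2)] by (cases "a1 = a2") simp_all
  qed
  have ev: "m (Edge e) (Vertex X) = Vertex (proj e X)" if prems: "e \<in> E" "X \<in> V" for e X
  proof -
    obtain A B where "e = {A, B}" using edgeE[OF prems(1)] by blast
    \<comment> \<open>Rule (4) reaches a vertex only as an endpoint of a second edge, so some edge
      at \<open>X\<close> has to be supplied.\<close>
    moreover obtain Y where "{X, Y} \<in> E" using edge_at[OF prems(2)] .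
    ultimately show ?thesis using rule4 prems by blast
  qed
  have ef: "m (Edge e) (Edge f) = Vertex (proj e X)"
    if prems: "e \<in> E" "f \<in> E" "X \<in> f" "fst (lab e) \<noteq> fst (lab f)" for e f X
  proof -
    obtain A B where "e = {A, B}" using edgeE[OF prems(1)] by blast
    moreover obtain Y where "f = {X, Y}"
      using edgeE[OF prems(2)] prems(3) by blast
    ultimately show ?thesis using rule4 prems by blast
  qed
  show ?thesis
    unfolding side_mult_def using v ev ee ef c4(2) by blast
qed

end

section \<open>Uniqueness of the multiplication\<close>

context thin_graph
begin

lemma side_mult_unique:
  assumes "side_mult m" "side_mult m'" "x \<in> elts V E" "y \<in> elts V E"
  shows "m x y = m' x y"
proof -
  note d = side_mult_vertex side_mult_edge_vertex side_mult_edge_edge_eq side_mult_Zero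
  consider "x = Zero" | "y = Zero" | A where "x = Vertex A" "A \<in> V"
    | e X where "x = Edge e" "e \<in> E" "y = Vertex X" "X \<in> V"
    | e f where "x = Edge e" "e \<in> E" "y = Edge f" "f \<in> E"
    using assms(3,4) unfolding elts_def by blast
  then show ?thesis
  proof cases
    case (5 e f)
    obtain X where "X \<in> f" using edgeE[OF \<open>f \<in> E\<close>] by blast
    then show ?thesis
      using 5 d(3)[OF assms(1)] d(3)[OF assms(2)] side_mult_edge_edge_neq[OF assms(1)]
        side_mult_edge_edge_neq[OF assms(2)] by (cases "fst (lab e) = fst (lab f)") simp_all
  qed (use assms(3,4) d[OF assms(1)] d[OF assms(2)] in simp_all)
qed

end


section \<open>The left regular band and its face poset\<close>

locale thin_side_mult = thin_connected_graph +
  fixes m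
  assumes side_mult: "side_mult m"
begin

abbreviation "S \<equiv> elts V E"

lemma S_cases [consumes 1]:
  assumes "x \<in> S"
  obtains (Zero) "x = Zero" | (Vertex) A where "x = Vertex A" "A \<in> V"
    | (Edge) e where "x = Edge e" "e \<in> E"
  using assms unfolding elts_def by blast

lemma in_S: "Zero \<in> S" "Vertex A \<in> S \<longleftrightarrow> A \<in> V" "Edge e \<in> S \<longleftrightarrow> e \<in> E"
  unfolding elts_def by auto

section \<open>The axioms of a left regular band\<close>

lemmas mult_vertex = side_mult_vertex[OF side_mult]
  and mult_edge_vertex = side_mult_edge_vertex[OF side_mult]
  and mult_edge_edge_eq = side_mult_edge_edge_eq[OF side_mult]
  and mult_edge_edge_neq = side_mult_edge_edge_neq[OF side_mult]
  and mult_Zero = side_mult_Zero[OF side_mult]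

text \<open>Closure, left regularity and the face order are read off from this dichotomy: an
  endpoint absorbs every factor on its right, and \<open>e\<close> is idempotent.\<close>

lemma mult_edge_cases:
  assumes "e \<in> E" "x \<in> S"
  obtains "m (Edge e) x = Edge e" | P where "P \<in> e" "m (Edge e) x = Vertex P"
  using assms(2)
proof (cases rule: S_cases)
  case Zero
  then show thesis using that(1) mult_Zero in_S assms by blast
next
  case (Vertex A)
  then show thesis using that(2) mult_edge_vertex proj_in assms by blast
next
  case (Edge f)
  obtain X where X: "X \<in> f" using edgeE[OF Edge(2)] by blast
  show thesis
  proof (cases "fst (lab e) = fst (lab f)")
    case True
    then show thesis using that(1) mult_edge_edge_eq assms Edge by simp
  next
    case False
    then show thesis
      using that(2)[OF proj_in[OF assms(1) in_V[OF Edge(2) X]]]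
        mult_edge_edge_neq[OF assms(1) Edge(2) False X] Edge(1) by simp
  qed
qed

lemma mult_closed:
  assumes "x \<in> S" "y \<in> S"
  shows "m x y \<in> S"
  using assms(1)
proof (cases rule: S_cases)
  case (Edge e)
  then show ?thesis
    using mult_edge_cases[OF Edge(2) assms(2)] in_V[OF Edge(2)] in_S by metis
qed (use mult_Zero mult_vertex assms in_S in simp_all)

text \<open>Vertices absorb on the right and \<open>Zero\<close> is neutral, so the first two
  factors may be taken to be edges \<open>e\<close> and \<open>f\<close>. The two cases depend on
  whether their first labels agree.\<close>

lemma mult_assoc:
  assumes "x \<in> S" "y \<in> S" "z \<in> S"
  shows "m (m x y) z = m x (m y z)"
  using assms(1)
proof (cases rule: S_cases)
  case Zero
  then show ?thesis using mult_Zero assms mult_closed by simp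
next
  case (Vertex A)
  then show ?thesis using mult_vertex assms mult_closed by simp
next
  case x: (Edge e)
  show ?thesis
    using assms(2)
  proof (cases rule: S_cases)
    case Zero
    then show ?thesis using mult_Zero assms by simp
  next
    case (Vertex A)
    then show ?thesis
      using mult_vertex[OF _ assms(3)] mult_edge_vertex x proj_in_V by simp
  next
    case y: (Edge f)
    show ?thesis
    proof (cases "fst (lab e) = fst (lab f)")
      case True
      \<comment> \<open>\<open>f\<close> moves \<open>X\<close> within its side for the common
        label, and \<open>e\<close> sees only that side.\<close>
      have proj: "proj e (proj f X) = proj e X" if "X \<in> V" for X
        using proj_cong[OF x(2) proj_in_V[OF y(2) that] that] proj_same_side[OF y(2) that] True
        by simp
      show ?thesis
        using assms(3)
      proof (cases rule: S_cases)
        case Zero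
        then show ?thesis using mult_Zero assms mult_closed by simp
      next
        case (Vertex X)
        then show ?thesis
          using proj True x y mult_edge_edge_eq mult_edge_vertex proj_in_V by simp
      next
        case z: (Edge g)
        obtain X where X: "X \<in> g" using edgeE[OF z(2)] by blast
        then show ?thesis
          using proj[OF in_V[OF z(2) X]] True x y z mult_edge_edge_eq mult_edge_vertex
            mult_edge_edge_neq[OF _ z(2) _ X] proj_in_V in_V[OF z(2) X]
          \<comment> \<open>If the label of \<open>g\<close> agrees too, both products are
            \<open>e\<close>; otherwise \<open>f\<close> times \<open>g\<close> is the vertex
            \<open>proj f X\<close>, and the identity above applies.\<close>
          by (cases "fst (lab f) = fst (lab g)") simp_all
      qed
    next
      case False
      \<comment> \<open>\<open>f\<close> times \<open>z\<close> is \<open>f\<close> or an endpoint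
        of \<open>f\<close>, and \<open>e\<close> sends all of these to the same vertex, which in
        turn absorbs \<open>z\<close>.\<close>
      have ef: "m x (Vertex P) = m x y" if "P \<in> f" for P
        using mult_edge_edge_neq[OF x(2) y(2) False that] mult_edge_vertex[OF x(2)]
          in_V[OF y(2) that] x y by simp
      obtain X where X: "X \<in> f" using edgeE[OF y(2)] by blast
      have "m (m x y) z = m x y"
        using mult_edge_edge_neq[OF x(2) y(2) False X] proj_in_V[OF x(2)] in_V[OF y(2) X]
          mult_vertex[OF _ assms(3)] x y by simp
      then show ?thesis
        using mult_edge_cases[OF y(2) assms(3)] ef y(1) by metis
    qed
  qed
qed

lemma mult_idem:
  assumes "x \<in> S"
  shows "m x x = x"
  using assms by (cases rule: S_cases)
    (use assms mult_Zero mult_vertex mult_edge_edge_eq in simp_all)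

lemma mult_left_regular:
  assumes "x \<in> S" "y \<in> S"
  shows "m (m x y) x = m x y"
  using assms(1)
proof (cases rule: S_cases)
  case (Edge e)
  then show ?thesis
    using mult_edge_cases[OF Edge(2) assms(2)] mult_idem[OF assms(1)]
      mult_vertex[OF in_V[OF Edge(2)] assms(1)] by metis
qed (use assms mult_Zero mult_vertex in simp_all)

lemma left_regular_band: "left_regular_band S m"
  unfolding left_regular_band_def
  using mult_closed mult_assoc mult_idem mult_left_regular by blast

text \<open>An element fixed by left multiplication with \<open>e\<close> is a product of
  \<open>e\<close>, hence \<open>e\<close> or one of its endpoints; conversely,
  \<open>proj e\<close> fixes exactly the endpoints of \<open>e\<close>.\<close>

lemma face_le_iff:
  assumes "y \<in> S" "x \<in> S"
  shows "face_le m y x \<longleftrightarrow> y = Zero \<or> y = x \<or> (\<exists>e\<in>E. \<exists>X\<in>e. y = Edge e \<and> x = Vertex X)"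
  using assms(1)
proof (cases rule: S_cases)
  case Zero
  then show ?thesis using mult_Zero assms by (simp add: face_le_def)
next
  case (Vertex A)
  then show ?thesis using mult_vertex assms by (auto simp: face_le_def)
next
  case (Edge e)
  have "m y x = x \<longleftrightarrow> y = x" if "\<not> (\<exists>X. x = Vertex X)"
    using mult_edge_cases[OF Edge(2) assms(2)] that Edge(1) mult_idem assms by metis
  moreover have "m y (Vertex X) = Vertex X \<longleftrightarrow> X \<in> e" if "X \<in> V" for X
    using mult_edge_vertex[OF Edge(2) that] proj_fixes_iff[OF Edge(2) that] Edge(1) by simp
  ultimately show ?thesis using Edge assms(2) in_S unfolding face_le_def by blast
qed

section \<open>Meets in the face poset\<close>

lemma partial_order: "partial_order (face_poset S m)"
proof (unfold_locales, simp_all add: face_poset_def)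
  fix x y z
  assume S: "x \<in> S" "y \<in> S"
  then show "face_le m x x" "face_le m x y \<Longrightarrow> face_le m y x \<Longrightarrow> x = y"
    by (auto simp: face_le_iff)
  assume "z \<in> S" "face_le m x y" "face_le m y z"
  then show "face_le m x z"
    using S by (auto simp: face_le_iff)
qed

text \<open>Incomparable elements have only \<open>Zero\<close> below both, unless they are the two
  ends of an edge. Two distinct vertices determine that edge, which is then the meet.\<close>

lemma meet_exists:
  assumes S: "x \<in> S" "y \<in> S"
  obtains s where "s \<in> S" "face_le m s x" "face_le m s y"
    "\<And>z. z \<in> S \<Longrightarrow> face_le m z x \<Longrightarrow> face_le m z y \<Longrightarrow> face_le m z s"
proof (cases "face_le m x y \<or> face_le m y x")
  case True
  then show thesis
    using that[of x] that[of y] S face_le_iff[of x x] face_le_iff[of y y] by blast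
next
  case incomparable: False
  then have ne: "x \<noteq> y" "x \<noteq> Zero" "y \<noteq> Zero" using S by (auto simp: face_le_iff)
  have Zero_le: "face_le m Zero z" if "z \<in> S" for z using that by (simp add: face_le_iff in_S)
  have below: "z = Zero \<or> (\<exists>e\<in>E. \<exists>A\<in>e. \<exists>B\<in>e. z = Edge e \<and> x = Vertex A \<and> y = Vertex B)"
    if "z \<in> S" "face_le m z x" "face_le m z y" for z
    using that incomparable S ne by (auto simp: face_le_iff)
  show thesis
  proof (cases "\<exists>e\<in>E. \<exists>A\<in>e. \<exists>B\<in>e. x = Vertex A \<and> y = Vertex B")
    case True
    then obtain e A B where e: "e \<in> E" "A \<in> e" "B \<in> e" "x = Vertex A" "y = Vertex B"
      by blast
    have unique: "f = {A, B}" if f: "f \<in> E" "A \<in> f" "B \<in> f" for f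
    proof -
      obtain C D where "f = {C, D}" using edgeE[OF f(1)] by blast
      then show ?thesis using f(2,3) e ne by auto
    qed
    have "face_le m z (Edge e)" if z: "z \<in> S" "face_le m z x" "face_le m z y" for z
    proof -
      have "z = Zero \<or> z = Edge e" using below[OF z] unique e by auto
      then show ?thesis using e(1) by (auto simp: face_le_iff in_S)
    qed
    moreover have "face_le m (Edge e) x" "face_le m (Edge e) y"
      using e S by (simp_all add: face_le_iff in_S)
    ultimately show thesis using that[of "Edge e"] e(1) in_S by blast
  next
    case False
    then have "z = Zero" if "z \<in> S" "face_le m z x" "face_le m z y" for z
      using below[OF that] by blast
    then show thesis using that[of Zero] Zero_le S in_S by blast
  qed
qed

lemma lower_semilattice: "lower_semilattice (face_poset S m)"
proof -
  interpret partial_order "face_poset S m" by (rule partial_order)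
  show ?thesis
  proof
    fix x y
    assume "x \<in> carrier (face_poset S m)" "y \<in> carrier (face_poset S m)"
    then have S: "x \<in> S" "y \<in> S" by (simp_all add: face_poset_def)
    obtain s where "s \<in> S" "face_le m s x" "face_le m s y"
      "\<And>z. z \<in> S \<Longrightarrow> face_le m z x \<Longrightarrow> face_le m z y \<Longrightarrow> face_le m z s"
      using meet_exists[OF S] by blast
    then show "\<exists>s. greatest (face_poset S m) s (Lower (face_poset S m) {x, y})"
      using S by (intro exI[of _ s]) (auto simp: greatest_def Lower_def face_poset_def)
  qed
qed

section \<open>Chambers, the adjacency graph and thinness\<close>

lemma S_empty:
  assumes "V = {}"
  shows "S = {Zero}"
proof -
  have "e \<notin> E" for e
  proof
    assume "e \<in> E"
    then show False using assms by (elim edgeE) simp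
  qed
  then show ?thesis using assms unfolding elts_def by auto
qed

text \<open>Without vertices there are no edges either, and \<open>Zero\<close> is the whole poset.
  Otherwise \<open>Zero\<close> lies below a vertex, each edge lies below its endpoints, and nothing
  lies above a vertex.\<close>

lemma chambers_eq: "chambers S m = (if V = {} then {Zero} else Vertex ` V)"
proof (cases "V = {}")
  case True
  then show ?thesis unfolding chambers_def S_empty[OF True] by auto
next
  case False
  have vertex: "Vertex A \<in> chambers S m" if "A \<in> V" for A
    using that by (simp add: chambers_def face_le_iff in_S)
  obtain A where "A \<in> V" using False by blast
  then have zero: "Zero \<notin> chambers S m"
    by (auto simp: chambers_def face_le_iff in_S intro!: bexI[of _ "Vertex A"])
  have edge: "Edge e \<notin> chambers S m" if e: "e \<in> E" for e
  proof -
    obtain X where X: "X \<in> e" using edgeE[OF e] by blast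
    have "Vertex X \<in> S" using in_V[OF e X] in_S by simp
    moreover from this have "face_le m (Edge e) (Vertex X)"
      using e X by (simp add: face_le_iff in_S)
    ultimately show ?thesis by (auto simp: chambers_def)
  qed
  have "chambers S m \<subseteq> Vertex ` V"
  proof
    fix x
    assume x: "x \<in> chambers S m"
    then have "x \<in> S" by (simp add: chambers_def)
    then show "x \<in> Vertex ` V" using x zero edge by (cases rule: S_cases) simp_all
  qed
  then show ?thesis using False vertex by auto
qed

lemma covers_vertex_iff:
  assumes "X \<in> V" "y \<in> S"
  shows "covers S m (Vertex X) y \<longleftrightarrow> (\<exists>e\<in>E. X \<in> e \<and> y = Edge e)"
  using assms(2)
proof (cases rule: S_cases)
  case Zero
  \<comment> \<open>An edge at \<open>X\<close> lies strictly between \<open>Zero\<close> and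
    \<open>X\<close>, so \<open>X\<close> does not cover \<open>Zero\<close>.\<close>
  obtain B where B: "{X, B} \<in> E" using edge_at[OF assms(1)] .
  then have "Edge {X, B} \<in> S" "face_le m Zero (Edge {X, B})" "face_le m (Edge {X, B}) (Vertex X)"
    using assms(1) by (simp_all add: face_le_iff in_S)
  then have "\<not> covers S m (Vertex X) Zero"
    unfolding covers_def by (auto intro!: bexI[of _ "Edge {X, B}"])
  then show ?thesis using Zero by simp
next
  case (Vertex A)
  then show ?thesis using assms by (auto simp: covers_def face_le_iff in_S)
next
  case (Edge e)
  have "z = Edge e \<or> z = Vertex X"
    if "z \<in> S" "face_le m (Edge e) z" "face_le m z (Vertex X)" for z
    using that Edge(2) assms(1) by (auto simp: face_le_iff in_S)
  moreover have "face_le m (Edge e) (Vertex X) \<longleftrightarrow> X \<in> e"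
    using Edge(2) assms(1) by (auto simp: face_le_iff in_S)
  ultimately have "covers S m (Vertex X) (Edge e) \<longleftrightarrow> X \<in> e"
    unfolding covers_def by blast
  then show ?thesis using Edge by auto
qed

lemma adjacency_edge:
  assumes "{x, y} \<in> E"
  shows "{Vertex x, Vertex y} \<in> snd ` adjacency_edges S m"
proof -
  have xy: "x \<in> V" "y \<in> V" "x \<noteq> y" using edge_in_V[OF assms] by simp_all
  then have "Vertex x \<in> chambers S m" "Vertex y \<in> chambers S m" by (auto simp: chambers_eq)
  moreover have "covers S m (Vertex x) (Edge {x, y})" "covers S m (Vertex y) (Edge {x, y})"
    using xy assms by (auto simp: covers_vertex_iff in_S)
  moreover have "Edge {x, y} \<in> S" "Vertex x \<noteq> Vertex y" using assms xy in_S by simp_all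
  ultimately have "(Edge {x, y}, {Vertex x, Vertex y}) \<in> adjacency_edges S m"
    unfolding adjacency_edges_def mem_Collect_eq by (intro exI conjI) (rule refl | assumption)+
  then show ?thesis by (rule rev_image_eqI) simp
qed

text \<open>Each edge of the graph is covered by its two endpoints, so \<open>Vertex\<close> carries
  walks of the graph to walks among the chambers.\<close>

lemma adjacency_connected:
  assumes "connected_graph V E"
  shows "connected_graph (chambers S m) (snd ` adjacency_edges S m)"
proof (cases "V = {}")
  case True
  then show ?thesis unfolding connected_graph_def chambers_eq by simp
next
  case False
  then have ch: "chambers S m = Vertex ` V" by (simp add: chambers_eq)
  let ?R = "{(x, y). x \<in> V \<and> y \<in> V \<and> {x, y} \<in> E}"
  let ?R' = "{(x, y). x \<in> chambers S m \<and> y \<in> chambers S m \<and> {x, y} \<in> snd ` adjacency_edges S m}"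
  have step: "(Vertex x, Vertex y) \<in> ?R'" if "(x, y) \<in> ?R" for x y
    using that adjacency_edge[of x y] unfolding ch by simp
  have lift: "(Vertex x, Vertex y) \<in> ?R'\<^sup>*" if "(x, y) \<in> ?R\<^sup>*" for x y
    using that
    by (induction rule: rtrancl_induct) (rule rtrancl_refl, erule rtrancl_into_rtrancl, erule step)
  show ?thesis
    unfolding connected_graph_def
  proof (intro ballI)
    fix C D
    assume "C \<in> chambers S m" "D \<in> chambers S m"
    then obtain x y where "C = Vertex x" "D = Vertex y" "x \<in> V" "y \<in> V"
      unfolding ch by (elim imageE)
    then show "(C, D) \<in> ?R'\<^sup>*"
      using lift[of x y] assms unfolding connected_graph_def by simp
  qed
qed

text \<open>A facet is covered by a vertex, hence is an edge, and the chambers above it are its two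
  endpoints.\<close>

lemma card_chambers_above_facet:
  assumes "x \<in> facets S m"
  shows "card {C \<in> chambers S m. face_le m x C} = 2"
proof -
  obtain C where C: "x \<in> S" "C \<in> chambers S m" "covers S m C x"
    using assms unfolding facets_def mem_Collect_eq by (elim conjE bexE)
  \<comment> \<open>A cover relation needs two distinct elements, while an empty \<open>V\<close>
    leaves only \<open>Zero\<close>.\<close>
  have "V \<noteq> {}"
  proof
    assume "V = {}"
    moreover have "C \<in> S" "x \<noteq> C" using C(2,3) unfolding chambers_def covers_def by simp_all
    ultimately show False using C(1) unfolding S_empty[OF \<open>V = {}\<close>] by simp
  qed
  then obtain X where X: "X \<in> V" "C = Vertex X" using C(2) by (auto simp: chambers_eq)
  then obtain e where e: "e \<in> E" "x = Edge e"
    using C(3) covers_vertex_iff[OF X(1) C(1)] by blast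
  have "{C \<in> chambers S m. face_le m x C} = Vertex ` e"
  proof -
    have "face_le m x (Vertex A) \<longleftrightarrow> A \<in> e" if "A \<in> V" for A
      using e that by (auto simp: face_le_iff in_S)
    then show ?thesis using \<open>V \<noteq> {}\<close> in_V[OF e(1)] by (auto simp: chambers_eq)
  qed
  moreover obtain A B where "e = {A, B}" "A \<noteq> B" using edgeE[OF e(1)] by blast
  ultimately show ?thesis by simp
qed

end

theorem theorem4p1:
  fixes V :: "'v set" and E :: "'v set set" and lab :: "'v set \<Rightarrow> nat \<times> nat"
    and sp :: "'v \<Rightarrow> 'v \<Rightarrow> 'v list"
  assumes "thin_LRB_graph V E lab"
    and "connected_graph V E"
    and "card V \<noteq> 1"
    and "minimal_path_choice V E sp"
  shows "(\<exists>m. graph_mult V E lab sp m) \<and>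
    (\<forall>m m'. graph_mult V E lab sp m \<and> graph_mult V E lab sp m' \<longrightarrow>
      (\<forall>x \<in> elts V E. \<forall>y \<in> elts V E. m x y = m' x y)) \<and>
    (\<forall>m. graph_mult V E lab sp m \<longrightarrow> thin_MC_LRB (elts V E) m)"
proof -
  interpret thin_connected_graph V E lab sp
    using assms by unfold_locales
  have "thin_MC_LRB (elts V E) m" if "graph_mult V E lab sp m" for m
  proof -
    \<comment> \<open>Since every vertex lies on an edge, the rules force the description by sides
      for an arbitrary \<open>m\<close>.\<close>
    interpret thin_side_mult V E lab sp m
      using graph_mult_side_mult[OF that] by unfold_locales
    show ?thesis
      unfolding thin_MC_LRB_def MC_LRB_def
      using left_regular_band lower_semilattice adjacency_connected[OF assms(2)]
        card_chambers_above_facet by simp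
  qed
  moreover have "\<exists>m. graph_mult V E lab sp m"
    using side_mult_ex side_mult_graph_mult by blast
  moreover have "m x y = m' x y"
    if "graph_mult V E lab sp m" "graph_mult V E lab sp m'" "x \<in> elts V E" "y \<in> elts V E"
    for m m' x y
    using side_mult_unique[OF that(1,2)[THEN graph_mult_side_mult] that(3,4)] .
  ultimately show ?thesis by simp
qed

end
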